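(* For $n\ge 1$, $1\le i\le n$ and $0\le j\le\lfloor(2n+1-i)/2\rfloor$, the partial $\gamma$-coefficient $\gamma_{n,i,j}$ of the trivariate second order Eulerian polynomial $C_n(x,y,z)$ equals the number of canonical ternary increasing trees on $[n]_2=\{1^2,2^2,\ldots,n^2\}$ with $i$ $y$-leaves and $j$ $z$-leaves.
   Context: A Stirling permutation of $[n]_2=\{1^2,2^2,\ldots,n^2\}$ (two copies of each of $1,\ldots,n$) is a permutation $\sigma=\sigma_1\cdots\sigma_{2n}$ of this multiset such that, for each $i$, all elements between the two occurrences of $i$ are greater than $i$. $Q_n$ is the set of these. Convention: $\sigma_0=\sigma_{2n+1}=0$. An index $1\le i\le 2n$ is an ascent if $\sigma_{i-1}<\sigma_i$, a descent if $\sigma_i>\sigma_{i+1}$, and a plateau if $\sigma_i=\sigma_{i+1}$; their numbers are $\mathrm{asc}(\sigma),\mathrm{des}(\sigma),\mathrm{plat}(\sigma)$. Define $$C_n(x,y,z)=\sum_{\sigma\in Q_n}x^{\mathrm{asc}(\sigma)}y^{\mathrm{des}(\sigma)}z^{\mathrm{plat}(\sigma)}.$$ This polynomial is symmetric in $x,y,z$. Its partial $\gamma$-coefficients $\gamma_{n,i,j}$ are the coefficients (uniquely) determined by $$C_n(x,y,z)=\sum_{i=1}^{n}z^i\sum_{j=0}^{\lfloor(2n+1-i)/2\rfloor}\gamma_{n,i,j}(xy)^j(x+y)^{2n+1-i-2j}.$$ A ternary increasing tree on $[n]_2$ is a rooted plane tree whose internal vertices are labeled by $1,\ldots,n$ (each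 used exactly once), whose external vertices (leaves) are unlabeled, such that each internal vertex has exactly three (linearly ordered) children and labels of internal vertices increase along every path from the root. A leaf is an $x$-leaf, a $z$-leaf or a $y$-leaf according to whether it is the first, the middle or the last child of its parent. Such a tree is called canonical (in the sense used here) if no internal vertex has a $z$-leaf but no $x$-leaf. *)

theory Defs
  imports "HOL-Library.Multiset" "HOL-Computational_Algebra.Polynomial"
begin

definition stirling_perms :: "nat \<Rightarrow> nat list set" where
  "stirling_perms n =
     {\<sigma>. mset \<sigma> = repeat_mset 2 (mset_set {1..n}) \<and>
          (\<forall>p q r. p < q \<and> q < r \<and> r < length \<sigma> \<and> \<sigma> ! p = \<sigma> ! r \<longrightarrow> \<sigma> ! p < \<sigma> ! q)}"

text \<open>
  The entry \<open>\<sigma>\<^sub>i\<close> of a word, with one-based indices and the boundary convention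
  \<open>\<sigma>\<^sub>0 = 0\<close> and \<open>\<sigma>\<^sub>m = 0\<close> for \<open>m = length \<sigma> + 1\<close>.
\<close>

definition entry :: "nat list \<Rightarrow> nat \<Rightarrow> nat" where
  "entry \<sigma> i = (if 1 \<le> i \<and> i \<le> length \<sigma> then \<sigma> ! (i - 1) else 0)"

definition asc :: "nat list \<Rightarrow> nat" where
  "asc \<sigma> = card {i \<in> {1..length \<sigma>}. entry \<sigma> (i - 1) < entry \<sigma> i}"

definition des :: "nat list \<Rightarrow> nat" where
  "des \<sigma> = card {i \<in> {1..length \<sigma>}. entry \<sigma> i > entry \<sigma> (i + 1)}"

definition plat :: "nat list \<Rightarrow> nat" where
  "plat \<sigma> = card {i \<in> {1..length \<sigma>}. entry \<sigma> i = entry \<sigma> (i + 1)}"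

text \<open>
  Trivariate integer polynomials are elements of the iterated polynomial ring
  \<open>\<int>[x][y][z]\<close>, with \<open>z\<close> as the outermost indeterminate.
\<close>

type_synonym poly3 = "int poly poly poly"

definition X :: poly3 where "X = [:[:[:0, 1:]:]:]"
definition Y :: poly3 where "Y = [:[:0, 1:]:]"
definition Z :: poly3 where "Z = [:0, 1:]"

definition second_order_eulerian :: "nat \<Rightarrow> poly3" where
  "second_order_eulerian n =
     (\<Sum>\<sigma>\<in>stirling_perms n. X ^ asc \<sigma> * Y ^ des \<sigma> * Z ^ plat \<sigma>)"

text \<open>
  A family of coefficients of the partial \<open>\<gamma>\<close>-expansion. Only the values with
  \<open>1 \<le> i \<le> n\<close> and \<open>j \<le> (2 * n + 1 - i) div 2\<close> occur in the expansion; the other values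
  are set to zero so that the family is determined as a function. In this range
  the subtractions in the exponent do not truncate.
\<close>

definition is_partial_gamma :: "nat \<Rightarrow> (nat \<Rightarrow> nat \<Rightarrow> int) \<Rightarrow> bool" where
  "is_partial_gamma n g \<longleftrightarrow>
     (\<forall>i j. \<not> (1 \<le> i \<and> i \<le> n \<and> j \<le> (2 * n + 1 - i) div 2) \<longrightarrow> g i j = 0) \<and>
     second_order_eulerian n =
       (\<Sum>i = 1..n. Z ^ i *
          (\<Sum>j = 0..(2 * n + 1 - i) div 2.
             of_int (g i j) * (X * Y) ^ j * (X + Y) ^ (2 * n + 1 - i - 2 * j)))"

definition partial_gamma :: "nat \<Rightarrow> nat \<Rightarrow> nat \<Rightarrow> int" where
  "partial_gamma n = (THE g. is_partial_gamma n g)"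

text \<open>The arguments of \<open>Node\<close> are the label and the first, middle and last child.\<close>

datatype ternary_tree = Leaf | Node nat ternary_tree ternary_tree ternary_tree

fun labels :: "ternary_tree \<Rightarrow> nat list" where
  "labels Leaf = []"
| "labels (Node a l m r) = a # labels l @ labels m @ labels r"

fun increasing :: "ternary_tree \<Rightarrow> bool" where
  "increasing Leaf \<longleftrightarrow> True"
| "increasing (Node a l m r) \<longleftrightarrow>
     (\<forall>b \<in> set (labels l) \<union> set (labels m) \<union> set (labels r). a < b) \<and>
     increasing l \<and> increasing m \<and> increasing r"

definition ternary_increasing_trees :: "nat \<Rightarrow> ternary_tree set" where
  "ternary_increasing_trees n = {t. mset (labels t) = mset_set {1..n} \<and> increasing t}"

fun y_leaves :: "ternary_tree \<Rightarrow> nat" where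
  "y_leaves Leaf = 0"
| "y_leaves (Node a l m r) =
     (if r = Leaf then 1 else 0) + y_leaves l + y_leaves m + y_leaves r"

fun z_leaves :: "ternary_tree \<Rightarrow> nat" where
  "z_leaves Leaf = 0"
| "z_leaves (Node a l m r) =
     (if m = Leaf then 1 else 0) + z_leaves l + z_leaves m + z_leaves r"

fun canonical :: "ternary_tree \<Rightarrow> bool" where
  "canonical Leaf \<longleftrightarrow> True"
| "canonical (Node a l m r) \<longleftrightarrow>
     \<not> (m = Leaf \<and> l \<noteq> Leaf) \<and> canonical l \<and> canonical m \<and> canonical r"

end

theory Submission
  imports Defs "HOL-Library.Sublist"
begin

text \<open>
  Both sides are compared through a sum over all increasing ternary trees.

  Reading a tree by writing each label twice, in the gaps between the words of the three
  subtrees, is a bijection from increasing trees onto Stirling permutations. Every gap of the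
  word (with a \<open>0\<close> added at both ends) corresponds to one leaf, and it is an ascent, a plateau
  or a descent according to the position of that leaf among its siblings. The expansion singles
  out \<open>z\<close>, which marks plateaux, whereas the trees are counted by their last leaves. The
  words are therefore read in the order first child, last child, middle child, so that plateaux
  are \<open>y\<close>-leaves and descents are \<open>z\<close>-leaves. This gives \<open>second_order_eulerian_eq_sum_trees\<close>.

  Next, the trees are grouped. At each vertex with a \<open>z\<close>-leaf but no \<open>x\<close>-leaf, exchange the
  first two children. The result is canonical, and a canonical tree is reached by choosing
  independently, at every vertex with an \<open>x\<close>-leaf but no \<open>z\<close>-leaf, on which side the leaf
  was. Each such vertex contributes a factor \<open>x + y\<close> to the total weight of the group, while the
  other \<open>x\<close>-leaves come in pairs with the \<open>z\<close>-leaves and contribute \<open>x y\<close>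
  (\<open>fibre_sum\<close>). Since a tree with \<open>n\<close> internal vertices has \<open>2 n + 1\<close> leaves, the number of
  factors \<open>x + y\<close> is exactly the exponent in the partial \<open>\<gamma>\<close>-expansion. Hence the
  numbers of canonical trees are coefficients of such an expansion.

  Finally the expansion is unique (\<open>is_partial_gamma_unique\<close>): powers of \<open>z\<close> are
  independent, and setting \<open>y = 0\<close> kills all terms \<open>(x y)^j (x + y)^(d - 2 j)\<close> except the one
  with \<open>j = 0\<close>, after which \<open>x y\<close> can be cancelled.
\<close>

section \<open>Stirling permutations as reading words of increasing trees\<close>

text \<open>
  The last child is read before the middle child. This is what makes plateaux correspond to
  \<open>y\<close>-leaves.
\<close>

fun reading_word :: "ternary_tree \<Rightarrow> nat list" where
  "reading_word Leaf = []"
| "reading_word (Node a l m r) = reading_word l @ a # reading_word r @ a # reading_word m"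

lemma mset_reading_word: "mset (reading_word t) = repeat_mset 2 (mset (labels t))"
  by (induction t) (auto simp: multiset_eq_iff)

lemma set_reading_word: "set (reading_word t) = set (labels t)"
  by (induction t) auto

text \<open>
  The Stirling condition as the avoidance of subsequences. In this form it passes to subwords
  for free and can be checked on a concatenation by distributing the pattern over the parts.
\<close>

definition nested :: "nat list \<Rightarrow> bool" where
  "nested w \<longleftrightarrow> (\<forall>b c. subseq [b, c, b] w \<longrightarrow> b < c)"

lemma subseq_triple_iff_nth:
  "subseq [a, b, c] w \<longleftrightarrow>
     (\<exists>p q r. p < q \<and> q < r \<and> r < length w \<and> w ! p = a \<and> w ! q = b \<and> w ! r = c)"
proof
  have first: "\<exists>us vs. w = us @ x # vs \<and> subseq xs vs" if "subseq (x # xs) w"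
    for x :: 'a and xs w
    using list_emb_ConsD[OF that] by auto
  assume "subseq [a, b, c] w"
  then obtain u v where w: "w = u @ a # v" and "subseq [b, c] v"
    by (meson first)
  then obtain u' v' where v: "v = u' @ b # v'" and "subseq [c] v'"
    by (meson first)
  then obtain s t where v': "v' = s @ c # t"
    by (meson first)
  have "w = u @ a # v" "w = (u @ a # u') @ b # v'" "w = (u @ a # u' @ b # s) @ c # t"
    using w v v' by simp_all
  then have "w ! length u = a" "w ! length (u @ a # u') = b" "w ! length (u @ a # u' @ b # s) = c"
    by (metis nth_append_length)+
  moreover have "length u < length (u @ a # u')"
    "length (u @ a # u') < length (u @ a # u' @ b # s)" "length (u @ a # u' @ b # s) < length w"
    using w v v' by simp_all
  ultimately show "\<exists>p q r. p < q \<and> q < r \<and> r < length w \<and> w ! p = a \<and> w ! q = b \<and> w ! r = c"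
    by blast
next
  assume "\<exists>p q r. p < q \<and> q < r \<and> r < length w \<and> w ! p = a \<and> w ! q = b \<and> w ! r = c"
  then obtain p q r where pqr: "p < q" "q < r" "r < length w"
    and eq: "w ! p = a" "w ! q = b" "w ! r = c" by blast
  have "a \<in> set (take q w)"
    using pqr eq by (force simp: in_set_conv_nth)
  moreover have "c \<in> set (drop (Suc q) w)"
    using pqr eq by (auto simp: in_set_conv_nth intro!: exI[of _ "r - Suc q"])
  ultimately have "subseq ([a] @ [b] @ [c]) (take q w @ [b] @ drop (Suc q) w)"
    by (intro list_emb_append_mono) (simp_all add: subseq_singleton_left)
  moreover have "w = take q w @ [b] @ drop (Suc q) w"
    using id_take_nth_drop[of q w] pqr eq by simp
  ultimately show "subseq [a, b, c] w" by simp
qed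

lemma nested_iff_nth:
  "nested w \<longleftrightarrow>
     (\<forall>p q r. p < q \<and> q < r \<and> r < length w \<and> w ! p = w ! r \<longrightarrow> w ! p < w ! q)"
  unfolding nested_def subseq_triple_iff_nth by metis

lemma nested_subseq: "nested w \<Longrightarrow> subseq v w \<Longrightarrow> nested v"
  unfolding nested_def by (meson subseq_order.trans)

lemma subseq_append_cases:
  shows "subseq [b, c] (u @ v) \<longleftrightarrow>
     subseq [b, c] u \<or> b \<in> set u \<and> c \<in> set v \<or> subseq [b, c] v"
    and "subseq [b, c, d] (u @ v) \<longleftrightarrow>
     subseq [b, c, d] u \<or> subseq [b, c] u \<and> d \<in> set v \<or> b \<in> set u \<and> subseq [c, d] v \<or>
     subseq [b, c, d] v"
  unfolding subseq_append_iff
  by (simp_all add: Cons_eq_append_conv subseq_singleton_left conj_disj_distribR ex_disj_distrib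
      conj_disj_distribL disj_ac cong: conj_cong)

text \<open>
  The words of different subtrees share no letter and the root label occurs in none of them. A
  pattern \<open>b c b\<close> therefore lies within the word of one subtree, or \<open>b\<close> is the root label and
  \<open>c\<close> is one of the larger labels in the middle of the word.
\<close>

lemma nested_reading_word:
  assumes "increasing t" "distinct (labels t)"
  shows "nested (reading_word t)"
  using assms
proof (induction t)
  case Leaf
  then show ?case by (simp add: nested_def)
next
  case (Node a l m r)
  let ?L = "reading_word l" and ?M = "reading_word m" and ?R = "reading_word r"
  have IH: "nested ?L" "nested ?M" "nested ?R"
    using Node by auto
  have gt: "\<And>b. b \<in> set ?L \<union> set ?M \<union> set ?R \<Longrightarrow> a < b"
    using Node.prems by (auto simp: set_reading_word)
  have disj: "set ?L \<inter> set ?M = {}" "set ?L \<inter> set ?R = {}" "set ?R \<inter> set ?M = {}"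
    using Node.prems by (auto simp: set_reading_word)
  have sub: "b \<in> set w \<and> c \<in> set w" if "subseq [b, c] w" for b c and w :: "nat list"
    using list_emb_set[OF that] by auto
  have nest: "subseq [b, c, b] ?L \<Longrightarrow> b < c" "subseq [b, c, b] ?M \<Longrightarrow> b < c"
    "subseq [b, c, b] ?R \<Longrightarrow> b < c" for b c
    using IH unfolding nested_def by blast+
  show ?case
    unfolding nested_def
  proof (intro allI impI)
    fix b c
    assume "subseq [b, c, b] (reading_word (Node a l m r))"
    then show "b < c"
      using gt disj
      by (auto simp: subseq_append_cases subseq_singleton_left disjoint_iff
          dest: nest dest!: sub split: if_splits)
  qed
qed

text \<open>
  The root label is recovered as the smallest letter, and its two occurrences cut the word into
  the words of the subtrees.
\<close>

lemma reading_word_inj: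
  assumes "reading_word s = reading_word t" "increasing s" "increasing t"
  shows "s = t"
  using assms
proof (induction s arbitrary: t)
  case Leaf
  then show ?case by (cases t) auto
next
  case (Node a l m r)
  from Node.prems obtain a' l' m' r' where t: "t = Node a' l' m' r'"
    by (cases t) auto
  have split: "takeWhile (\<lambda>b. b \<noteq> a) (u @ a # v) = u" "dropWhile (\<lambda>b. b \<noteq> a) (u @ a # v) = a # v"
    if "a \<notin> set u" for a :: nat and u v
    using that by (auto simp: takeWhile_append dropWhile_append)
  have gt: "\<forall>b \<in> set (labels l) \<union> set (labels m) \<union> set (labels r). a < b"
    and gt': "\<forall>b \<in> set (labels l') \<union> set (labels m') \<union> set (labels r'). a' < b"
    using Node.prems t by auto
  have "set (labels (Node a l m r)) = set (labels t)"
    using Node.prems(1) by (metis set_reading_word)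
  then have "a = a'"
    using gt gt' unfolding t by simp (metis (no_types) UnE UnI1 UnI2 insert_iff less_asym)
  have out: "a \<notin> set (reading_word u)" if "u \<in> {l, m, r, l', m', r'}" for u
    using that gt gt' \<open>a = a'\<close> by (auto simp: set_reading_word)
  have eq: "reading_word l @ a # reading_word r @ a # reading_word m =
        reading_word l' @ a # reading_word r' @ a # reading_word m'"
    using Node.prems(1) t \<open>a = a'\<close> by simp
  have 1: "reading_word l = reading_word l'"
    using arg_cong[OF eq, of "takeWhile (\<lambda>b. b \<noteq> a)"] by (simp add: split out)
  with eq have eq': "reading_word r @ a # reading_word m = reading_word r' @ a # reading_word m'"
    by simp
  have 2: "reading_word r = reading_word r'"
    using arg_cong[OF eq', of "takeWhile (\<lambda>b. b \<noteq> a)"] by (simp add: split out)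
  with eq' have 3: "reading_word m = reading_word m'"
    by simp
  show ?case
    using Node.IH Node.prems 1 2 3 \<open>a = a'\<close> by (simp add: t)
qed

text \<open>
  The two occurrences of the smallest letter \<open>a\<close> cut the word into three parts. A letter
  \<open>b\<close> common to two parts would enclose a copy of \<open>a < b\<close>; so both copies of every other letter
  lie in the same part, and each part is again the word of a tree.
\<close>

lemma reading_word_surj:
  assumes "nested w" "\<And>b. count (mset w) b \<in> {0, 2}"
  shows "\<exists>t. increasing t \<and> reading_word t = w"
  using assms
proof (induction w rule: length_induct)
  case (1 w)
  show ?case
  proof (cases "w = []")
    case True
    then show ?thesis by (intro exI[of _ Leaf]) simp
  next
    case False
    define a where "a = Min (set w)"
    have "a \<in> set w" using False by (simp add: a_def)
    then obtain u v where uv: "w = u @ a # v" "a \<notin> set u"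
      by (meson split_list_first)
    have zero: "count (mset u) b = 0" if "b \<notin> set u" for b :: nat and u
      using that by (metis count_eq_zero_iff set_mset_mset)
    have "count (mset w) a = 2"
      using 1(3)[of a] \<open>a \<in> set w\<close> by auto
    then have "count (mset v) a = 1"
      using uv zero[of a u] by simp
    then have "a \<in> set v"
      by (metis count_eq_zero_iff set_mset_mset zero_neq_one)
    then obtain v1 v2 where v: "v = v1 @ a # v2" "a \<notin> set v1"
      by (meson split_list_first)
    have "count (mset v2) a = 0"
      using \<open>count (mset v) a = 1\<close> v zero[of a v1] by simp
    then have "a \<notin> set v2"
      by (metis count_eq_zero_iff set_mset_mset)
    have w: "w = u @ a # v1 @ a # v2" using uv v by simp
    have gt: "a < b" if "b \<in> set u \<union> set v1 \<union> set v2" for b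
    proof -
      have "b \<in> set w" using that w by auto
      then have "a \<le> b" by (simp add: a_def)
      moreover have "a \<noteq> b" using that uv(2) v(2) \<open>a \<notin> set v2\<close> by blast
      ultimately show ?thesis by simp
    qed
    have "\<not> (b \<in> set u \<and> b \<in> set v1 \<or> b \<in> set u \<and> b \<in> set v2 \<or> b \<in> set v1 \<and> b \<in> set v2)" for b
    proof
      assume b: "b \<in> set u \<and> b \<in> set v1 \<or> b \<in> set u \<and> b \<in> set v2 \<or> b \<in> set v1 \<and> b \<in> set v2"
      then have "subseq [b, a, b] w"
        by (auto simp: w subseq_append_cases subseq_singleton_left)
      then have "b < a" using 1(2) unfolding nested_def by blast
      then show False using b gt[of b] by auto
    qed
    then have disj: "set u \<inter> set v1 = {}" "set u \<inter> set v2 = {}" "set v1 \<inter> set v2 = {}"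
      by blast+
    have cnt: "count (mset w) b = count (mset u) b + count (mset v1) b + count (mset v2) b"
      if "b \<noteq> a" for b
      using that by (simp add: w)
    have part: "\<exists>t. increasing t \<and> reading_word t = x"
      if x: "x \<in> {u, v1, v2}" for x
    proof -
      have "length x < length w" using x by (auto simp: w)
      moreover have "subseq x w"
        using x by (auto simp: w intro: list_emb_append2 subseq_order.refl)
      then have "nested x" using 1(2) nested_subseq by blast
      moreover have "count (mset x) b \<in> {0, 2}" for b
      proof (cases "b \<in> set x")
        case True
        then have "b \<noteq> a" using gt x by auto
        then have "count (mset w) b = count (mset x) b"
          using cnt[of b] x True disj zero[of b]
          by (auto simp: disjoint_iff)
        then show ?thesis using 1(3)[of b] by simp
      next
        case False
        then show ?thesis by (simp add: zero)
      qed
      ultimately show ?thesis using 1(1) by blast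
    qed
    obtain l where l: "increasing l" "reading_word l = u" using part by blast
    obtain r where r: "increasing r" "reading_word r = v1" using part by blast
    obtain m where m: "increasing m" "reading_word m = v2" using part by blast
    have "increasing (Node a l m r)"
      using l r m gt by (auto simp flip: set_reading_word)
    moreover have "reading_word (Node a l m r) = w"
      using l r m w by simp
    ultimately show ?thesis by blast
  qed
qed

lemma bij_betw_reading_word:
  "bij_betw reading_word (ternary_increasing_trees n) (stirling_perms n)"
  unfolding bij_betw_def
proof
  show "inj_on reading_word (ternary_increasing_trees n)"
    by (auto simp: inj_on_def ternary_increasing_trees_def intro: reading_word_inj)
  show "reading_word ` ternary_increasing_trees n = stirling_perms n"
  proof (intro subset_antisym subsetI)
    fix w assume "w \<in> reading_word ` ternary_increasing_trees n"
    then obtain t where t: "w = reading_word t" "mset (labels t) = mset_set {1..n}" "increasing t"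
      by (auto simp: ternary_increasing_trees_def)
    have "distinct (labels t)"
      using t(2) by (metis distinct_count_atmost_1 count_mset_set(1) count_mset_set(3)
          finite_atLeastAtMost finite_set_mset_mset_set set_mset_mset)
    then show "w \<in> stirling_perms n"
      using nested_reading_word[OF t(3)] t
      by (simp add: stirling_perms_def mset_reading_word nested_iff_nth)
  next
    fix w assume w: "w \<in> stirling_perms n"
    then have ms: "mset w = repeat_mset 2 (mset_set {1..n})" and "nested w"
      by (auto simp: stirling_perms_def nested_iff_nth)
    moreover have "count (mset w) b \<in> {0, 2}" for b
      by (cases "b \<in> {1..n}") (simp_all add: ms)
    ultimately obtain t where t: "increasing t" "reading_word t = w"
      using reading_word_surj by blast
    then have "repeat_mset 2 (mset (labels t)) = repeat_mset 2 (mset_set {1..n})"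
      using ms mset_reading_word by metis
    then have "mset (labels t) = mset_set {1..n}"
      by (simp add: repeat_mset_cancel1)
    with t show "w \<in> reading_word ` ternary_increasing_trees n"
      by (auto simp: ternary_increasing_trees_def)
  qed
qed

lemma finite_stirling_perms: "finite (stirling_perms n)"
proof (rule finite_subset)
  show "stirling_perms n \<subseteq> {w. set w \<subseteq> {1..n} \<and> length w = 2 * n}"
  proof
    fix w assume "w \<in> stirling_perms n"
    then have ms: "mset w = repeat_mset 2 (mset_set {1..n})"
      by (simp add: stirling_perms_def)
    have "length w = 2 * n"
      using arg_cong[OF ms, of size] by simp
    moreover have "set w \<subseteq> {1..n}"
      using arg_cong[OF ms, of set_mset] by (simp add: numeral_2_eq_2)
    ultimately show "w \<in> {w. set w \<subseteq> {1..n} \<and> length w = 2 * n}" by simp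
  qed
qed (simp add: finite_lists_length_eq)

lemma finite_ternary_increasing_trees: "finite (ternary_increasing_trees n)"
  using bij_betw_finite[OF bij_betw_reading_word] finite_stirling_perms by blast

section \<open>Leaves and steps\<close>

fun x_leaves :: "ternary_tree \<Rightarrow> nat" where
  "x_leaves Leaf = 0"
| "x_leaves (Node a l m r) =
     (if l = Leaf then 1 else 0) + x_leaves l + x_leaves m + x_leaves r"

text \<open>
  Ascents, descents and plateaux are all pairs of neighbours in the word padded by a \<open>0\<close> at
  both ends. Counting them by one function that is additive under cutting a word at a letter
  treats the three statistics alike.
\<close>

definition steps :: "(nat \<Rightarrow> nat \<Rightarrow> bool) \<Rightarrow> nat list \<Rightarrow> nat" where
  "steps R w = card {i. Suc i < length w \<and> R (w ! i) (w ! Suc i)}"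

lemma steps_singleton [simp]: "steps R [a] = 0"
  by (simp add: steps_def)

lemma steps_Cons [simp]: "steps R (a # b # w) = of_bool (R a b) + steps R (b # w)"
proof -
  let ?A = "{i. Suc i < length (b # w) \<and> R ((b # w) ! i) ((b # w) ! Suc i)}"
  have "{i. Suc i < length (a # b # w) \<and> R ((a # b # w) ! i) ((a # b # w) ! Suc i)} =
      {i. i = 0 \<and> R a b} \<union> Suc ` ?A"
    by (rule set_eqI, rename_tac i, case_tac i) (auto simp: image_iff)
  moreover have "finite ?A"
    by (rule finite_subset[of _ "{..length w}"]) auto
  then have "card ({i. i = 0 \<and> R a b} \<union> Suc ` ?A) = card {i::nat. i = 0 \<and> R a b} + card ?A"
    by (subst card_Un_disjoint) (auto simp: card_image)
  ultimately show ?thesis by (simp add: steps_def)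
qed

lemma steps_append: "steps R (u @ a # v) = steps R (u @ [a]) + steps R (a # v)"
proof (induction u)
  case (Cons b u)
  then show ?case by (cases u) auto
qed simp

lemma steps_Node:
  "steps R (p # reading_word (Node a l m r) @ [q]) =
     steps R (p # reading_word l @ [a]) + steps R (a # reading_word r @ [a]) +
     steps R (a # reading_word m @ [q])"
  using steps_append[of R "p # reading_word l" a "reading_word r @ a # reading_word m @ [q]"]
    steps_append[of R "a # reading_word r" a "reading_word m @ [q]"]
  by simp

text \<open>
  Each subtree of a vertex \<open>a\<close> sits between two letters \<open>p\<close> and \<open>q\<close> smaller than all of its
  labels. An empty subtree leaves \<open>p\<close> next to \<open>q\<close>, and this pair is \<open>p < a\<close> for a first child,
  \<open>a = a\<close> for a last child and \<open>a > q\<close> for a middle child. The values of \<open>p\<close> and \<open>q\<close> influence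
  the count only for the empty tree.
\<close>

lemma steps_reading_word:
  assumes "increasing t" "\<forall>b \<in> set (labels t). p < b \<and> q < b"
  shows "steps (<) (p # reading_word t @ [q]) = (if t = Leaf then of_bool (p < q) else x_leaves t)"
    and "steps (>) (p # reading_word t @ [q]) = (if t = Leaf then of_bool (p > q) else z_leaves t)"
    and "steps (=) (p # reading_word t @ [q]) = (if t = Leaf then of_bool (p = q) else y_leaves t)"
  using assms
proof (induction t arbitrary: p q)
  case Leaf
  {
    case 1 then show ?case by simp
  next
    case 2 then show ?case by simp
  next
    case 3 then show ?case by simp
  }
next
  case (Node a l m r)
  {
    case 1 
    then show ?case using Node.IH(1)[of p a] Node.IH(4)[of a q] Node.IH(7)[of a a]
      by (simp only: steps_Node) auto
  next
    case 2 
    then show ?case using Node.IH(2)[of p a] Node.IH(5)[of a q] Node.IH(8)[of a a]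
      by (simp only: steps_Node) auto
  next
    case 3
    then show ?case using Node.IH(3)[of p a] Node.IH(6)[of a q] Node.IH(9)[of a a]
      by (simp only: steps_Node) auto
  }
qed

lemma entry_eq_nth: "i \<le> Suc (length w) \<Longrightarrow> entry w i = (0 # w @ [0]) ! i"
  by (cases i) (auto simp: entry_def nth_append)

lemma asc_eq_steps: "asc w = steps (<) (0 # w @ [0])"
proof -
  have "{i \<in> {1..length w}. entry w (i - 1) < entry w i} =
      Suc ` {i. Suc i < length (0 # w @ [0]) \<and> (0 # w @ [0]) ! i < (0 # w @ [0]) ! Suc i}"
    (is "?A = Suc ` ?B")
  proof (intro subset_antisym subsetI)
    fix i assume "i \<in> ?A"
    then show "i \<in> Suc ` ?B"
      by (cases i) (auto simp: entry_eq_nth)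
  next
    fix i assume "i \<in> Suc ` ?B"
    then obtain k where k: "i = Suc k" "k \<le> length w" "(0 # w @ [0]) ! k < (w @ [0]) ! k"
      by auto
    \<comment> \<open>The last pair ends in the padding \<open>0\<close>, so it is not an ascent.\<close>
    then have "k \<noteq> length w" by (auto simp: nth_append)
    with k show "i \<in> ?A" by (auto simp: entry_eq_nth)
  qed
  then show ?thesis by (simp add: asc_def steps_def card_image)
qed

lemma des_eq_steps: "des w = steps (>) (0 # w @ [0])"
proof -
  have "{i \<in> {1..length w}. entry w i > entry w (i + 1)} =
      {i. Suc i < length (0 # w @ [0]) \<and> (0 # w @ [0]) ! i > (0 # w @ [0]) ! Suc i}"
    by (rule set_eqI, rename_tac i, case_tac i) (auto simp: entry_eq_nth)
  then show ?thesis by (simp add: des_def steps_def)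
qed

text \<open>
  The pair at the left end is counted by \<open>steps\<close> but not by \<open>plat\<close>, so its entries must differ.
\<close>

lemma plat_eq_steps:
  assumes "w \<noteq> []" "0 \<notin> set w"
  shows "plat w = steps (=) (0 # w @ [0])"
proof -
  have "w ! 0 \<noteq> 0" using assms by (metis length_greater_0_conv nth_mem)
  then have "{i \<in> {1..length w}. entry w i = entry w (i + 1)} =
      {i. Suc i < length (0 # w @ [0]) \<and> (0 # w @ [0]) ! i = (0 # w @ [0]) ! Suc i}"
    using assms
    by (intro set_eqI, rename_tac i, case_tac i) (auto simp: entry_eq_nth nth_append)
  then show ?thesis by (simp add: plat_def steps_def)
qed

lemma reading_word_statistics:
  assumes "t \<in> ternary_increasing_trees n" "n \<ge> 1"
  shows "asc (reading_word t) = x_leaves t" "des (reading_word t) = z_leaves t"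
    "plat (reading_word t) = y_leaves t"
proof -
  have inc: "increasing t" and ms: "mset (labels t) = mset_set {1..n}"
    using assms by (auto simp: ternary_increasing_trees_def)
  have set: "set (labels t) = {1..n}"
    using arg_cong[OF ms, of set_mset] by simp
  then have t: "t \<noteq> Leaf" using assms(2) by auto
  have "reading_word t \<noteq> []" using t by (cases t) auto
  moreover have "0 \<notin> set (reading_word t)" by (simp add: set_reading_word set)
  ultimately show "plat (reading_word t) = y_leaves t"
    using steps_reading_word(3)[OF inc, of 0 0] t set by (simp add: plat_eq_steps)
  show "asc (reading_word t) = x_leaves t" "des (reading_word t) = z_leaves t"
    using steps_reading_word(1,2)[OF inc, of 0 0] t set by (simp_all add: asc_eq_steps des_eq_steps)
qed

lemma second_order_eulerian_eq_sum_trees: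
  assumes "n \<ge> 1"
  shows "second_order_eulerian n =
    (\<Sum>t \<in> ternary_increasing_trees n. X ^ x_leaves t * Y ^ z_leaves t * Z ^ y_leaves t)"
  unfolding second_order_eulerian_def
  by (subst sum.reindex_bij_betw[OF bij_betw_reading_word, symmetric])
     (intro sum.cong refl, simp only: reading_word_statistics[OF _ assms])

section \<open>Moving leaves to the front\<close>

text \<open>
  Exchanging two leaves changes nothing, so testing the middle child alone alters only the
  vertices with a \<open>z\<close>-leaf but no \<open>x\<close>-leaf.
\<close>

fun canonicalize :: "ternary_tree \<Rightarrow> ternary_tree" where
  "canonicalize Leaf = Leaf"
| "canonicalize (Node a l m r) =
     (if m = Leaf then Node a Leaf (canonicalize l) (canonicalize r)
      else Node a (canonicalize l) (canonicalize m) (canonicalize r))"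

lemma canonicalize_eq_Leaf_iff [simp]: "canonicalize t = Leaf \<longleftrightarrow> t = Leaf"
  by (cases t) auto

lemma mset_labels_canonicalize: "mset (labels (canonicalize t)) = mset (labels t)"
  by (induction t) auto

lemma set_labels_canonicalize: "set (labels (canonicalize t)) = set (labels t)"
  by (metis mset_labels_canonicalize set_mset_mset)

lemma increasing_canonicalize: "increasing (canonicalize t) \<longleftrightarrow> increasing t"
  by (induction t) (auto simp: set_labels_canonicalize)

lemma canonical_canonicalize: "canonical (canonicalize t)"
  by (induction t) auto

text \<open>
  These are the vertices of a canonical tree at which a choice was lost: the \<open>x\<close>-leaf may have
  been a \<open>z\<close>-leaf before the exchange.
\<close>

fun lone_x_leaves :: "ternary_tree \<Rightarrow> nat" where
  "lone_x_leaves Leaf = 0"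
| "lone_x_leaves (Node a l m r) =
     (if l = Leaf \<and> m \<noteq> Leaf then 1 else 0) + lone_x_leaves l + lone_x_leaves m + lone_x_leaves r"

lemma fibre_Node:
  fixes l m r :: ternary_tree
  defines "F \<equiv> \<lambda>t. {s. canonicalize s = t}"
  assumes "canonical (Node a l m r)"
  shows "F (Node a l m r) = (\<lambda>(l, m, r). Node a l m r) ` (F l \<times> F m \<times> F r) \<union>
    (if l = Leaf \<and> m \<noteq> Leaf then (\<lambda>(m, r). Node a m Leaf r) ` (F m \<times> F r) else {})"
proof (rule set_eqI)
  fix s
  show "s \<in> F (Node a l m r) \<longleftrightarrow> s \<in> (\<lambda>(l, m, r). Node a l m r) ` (F l \<times> F m \<times> F r) \<union>
    (if l = Leaf \<and> m \<noteq> Leaf then (\<lambda>(m, r). Node a m Leaf r) ` (F m \<times> F r) else {})"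
    using assms by (cases s) (auto simp: F_def image_iff)
qed

text \<open>
  The total weight of all trees with the same canonical form factorises over the vertices. A
  vertex with an \<open>x\<close>-leaf but no \<open>z\<close>-leaf has two preimages, differing by a factor \<open>x\<close>
  against \<open>y\<close>; every other vertex has one.
\<close>

lemma fibre_sum:
  fixes x y z :: "'a :: comm_semiring_1"
  assumes "canonical t"
  shows "finite {s. canonicalize s = t} \<and>
    (\<Sum>s | canonicalize s = t. x ^ x_leaves s * y ^ z_leaves s * z ^ y_leaves s) =
       z ^ y_leaves t * (x * y) ^ z_leaves t * (x + y) ^ lone_x_leaves t"
  using assms
proof (induction t)
  case Leaf
  then show ?case by simp
next
  case (Node a l m r)
  define F where "F = (\<lambda>t. {s. canonicalize s = t})"
  define w where "w = (\<lambda>s. x ^ x_leaves s * y ^ z_leaves s * z ^ y_leaves s)"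
  define v where "v = (\<lambda>t. z ^ y_leaves t * (x * y) ^ z_leaves t * (x + y) ^ lone_x_leaves t)"
  have fin: "finite (F l)" "finite (F m)" "finite (F r)"
    and S: "sum w (F l) = v l" "sum w (F m) = v m" "sum w (F r) = v r"
    using Node by (auto simp: F_def w_def v_def)
  \<comment> \<open>\<open>A\<close> keeps the first two children in place at the root, and \<open>B\<close> exchanges them.\<close>
  define A where "A = (\<lambda>(l, m, r). Node a l m r) ` (F l \<times> F m \<times> F r)"
  define B where "B = (\<lambda>(m, r). Node a m Leaf r) ` (F m \<times> F r)"
  have FN: "F (Node a l m r) = A \<union> (if l = Leaf \<and> m \<noteq> Leaf then B else {})"
    unfolding A_def B_def F_def by (rule fibre_Node[OF Node.prems])
  have finAB: "finite A" "finite B"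
    using fin by (auto simp: A_def B_def)
  have leaf: "s \<in> F t \<Longrightarrow> s = Leaf \<longleftrightarrow> t = Leaf" for s t
    by (auto simp: F_def)
  have sumA: "sum w A = (if l = Leaf then x else 1) * (if m = Leaf then y else 1) *
      (if r = Leaf then z else 1) * (v l * v m * v r)" (is "_ = ?c * _")
  proof -
    have "sum w A = (\<Sum>(l', m', r') \<in> F l \<times> F m \<times> F r. w (Node a l' m' r'))"
      unfolding A_def by (subst sum.reindex) (auto simp: inj_on_def intro!: sum.cong)
    also have "\<dots> = (\<Sum>(l', m', r') \<in> F l \<times> F m \<times> F r. ?c * (w l' * (w m' * w r')))"
    proof (intro sum.cong refl, clarify)
      fix l' m' r' assume "l' \<in> F l" "m' \<in> F m" "r' \<in> F r"
      then show "w (Node a l' m' r') = ?c * (w l' * (w m' * w r'))"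
        using leaf[of l' l] leaf[of m' m] leaf[of r' r]
        by (simp add: w_def power_add ac_simps)
    qed
    also have "\<dots> = ?c * (v l * v m * v r)"
      by (simp add: sum.cartesian_product[symmetric] sum_distrib_left[symmetric]
          sum_distrib_right[symmetric] S mult.assoc)
    finally show ?thesis .
  qed
  have sumB: "sum w B = y * (if r = Leaf then z else 1) * (v m * v r)" (is "_ = ?d * _")
    if "m \<noteq> Leaf"
  proof -
    have "sum w B = (\<Sum>(m', r') \<in> F m \<times> F r. w (Node a m' Leaf r'))"
      unfolding B_def by (subst sum.reindex) (auto simp: inj_on_def intro!: sum.cong)
    also have "\<dots> = (\<Sum>(m', r') \<in> F m \<times> F r. ?d * (w m' * w r'))"
    proof (intro sum.cong refl, clarify)
      fix m' r' assume "m' \<in> F m" "r' \<in> F r"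
      then show "w (Node a m' Leaf r') = ?d * (w m' * w r')"
        using leaf[of m' m] leaf[of r' r] that
        by (simp add: w_def power_add ac_simps)
    qed
    also have "\<dots> = ?d * (v m * v r)"
      by (simp add: sum.cartesian_product[symmetric] sum_distrib_left[symmetric]
          sum_distrib_right[symmetric] S mult.assoc)
    finally show ?thesis .
  qed
  have "sum w (F (Node a l m r)) = v (Node a l m r)"
  proof (cases "l = Leaf \<and> m \<noteq> Leaf")
    case True
    then have "A \<inter> B = {}"
      by (auto simp: A_def B_def F_def)
    then have "sum w (F (Node a l m r)) = sum w A + sum w B"
      using True finAB unfolding FN by (simp add: sum.union_disjoint)
    also have "\<dots> = (x + y) * ((if r = Leaf then z else 1) * (v m * v r))"
      using True by (simp add: sumA sumB v_def algebra_simps)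
    also have "\<dots> = v (Node a l m r)"
      using True by (simp add: v_def power_add mult_ac)
    finally show ?thesis .
  next
    case False
    then have *: "l = Leaf \<longleftrightarrow> m = Leaf" using Node.prems by auto
    have "sum w (F (Node a l m r)) = sum w A"
      unfolding FN by (simp only: False if_False Un_empty_right)
    also have "\<dots> = v (Node a l m r)"
      using * unfolding sumA by (auto simp: v_def power_add mult_ac power_mult_distrib)
    finally show ?thesis .
  qed
  moreover have "finite (F (Node a l m r))"
    using finAB by (simp add: FN)
  ultimately show ?case by (simp add: F_def w_def v_def)
qed

lemma sum_trees_eq_sum_canonical:
  fixes x y z :: "'a :: comm_semiring_1"
  shows "(\<Sum>t \<in> ternary_increasing_trees n. x ^ x_leaves t * y ^ z_leaves t * z ^ y_leaves t) =
    (\<Sum>t \<in> {t \<in> ternary_increasing_trees n. canonical t}.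
       z ^ y_leaves t * (x * y) ^ z_leaves t * (x + y) ^ lone_x_leaves t)"
proof -
  let ?T = "ternary_increasing_trees n"
  let ?w = "\<lambda>t. x ^ x_leaves t * y ^ z_leaves t * z ^ y_leaves t"
  have iff: "canonicalize t \<in> ?T \<longleftrightarrow> t \<in> ?T" for t
    by (simp add: ternary_increasing_trees_def mset_labels_canonicalize increasing_canonicalize)
  have "sum ?w ?T =
      (\<Sum>t \<in> {t \<in> ?T. canonical t}. sum ?w {s \<in> ?T. canonicalize s = t})"
    by (rule sum.group[symmetric])
       (auto simp: finite_ternary_increasing_trees iff canonical_canonicalize)
  also have "\<dots> = (\<Sum>t \<in> {t \<in> ?T. canonical t}. sum ?w {s. canonicalize s = t})"
    using iff by (intro sum.cong arg_cong2[of _ _ _ _ sum]) auto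
  also have "\<dots> = (\<Sum>t \<in> {t \<in> ?T. canonical t}.
       z ^ y_leaves t * (x * y) ^ z_leaves t * (x + y) ^ lone_x_leaves t)"
    by (intro sum.cong) (simp_all add: fibre_sum)
  finally show ?thesis .
qed

lemma number_of_leaves: 
  "t \<noteq> Leaf \<Longrightarrow> x_leaves t + y_leaves t + z_leaves t = 2 * length (labels t) + 1"
proof (induction t)
  case (Node a l m r)
  then show ?case
    by (cases "l = Leaf"; cases "m = Leaf"; cases "r = Leaf") simp_all
qed simp

lemma y_leaves_le: "y_leaves t \<le> length (labels t)"
  by (induction t) auto

lemma y_leaves_pos: "t \<noteq> Leaf \<Longrightarrow> y_leaves t \<ge> 1"
  by (induction t) auto

text \<open>
  In a canonical tree every \<open>z\<close>-leaf has an \<open>x\<close>-leaf as a sibling.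
\<close>

lemma x_leaves_canonical: "canonical t \<Longrightarrow> x_leaves t = z_leaves t + lone_x_leaves t"
  by (induction t) auto

lemma canonical_leaf_counts:
  assumes "t \<in> ternary_increasing_trees n" "canonical t" "n \<ge> 1"
  shows "1 \<le> y_leaves t" "y_leaves t \<le> n" "z_leaves t \<le> (2 * n + 1 - y_leaves t) div 2"
    "lone_x_leaves t = 2 * n + 1 - y_leaves t - 2 * z_leaves t"
proof -
  have "mset (labels t) = mset_set {1..n}"
    using assms(1) by (simp add: ternary_increasing_trees_def)
  from arg_cong[OF this, of size] have len: "length (labels t) = n" by simp
  then have t: "t \<noteq> Leaf" using assms(3) by auto
  show "1 \<le> y_leaves t" "y_leaves t \<le> n"
    using y_leaves_pos[OF t] y_leaves_le[of t] len by auto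
  show "z_leaves t \<le> (2 * n + 1 - y_leaves t) div 2"
    "lone_x_leaves t = 2 * n + 1 - y_leaves t - 2 * z_leaves t"
    using number_of_leaves[OF t] x_leaves_canonical[OF assms(2)] len by auto
qed

text \<open>
  Outside the range of the expansion the counts vanish by \<open>canonical_leaf_counts\<close>, as the
  normalisation in \<open>is_partial_gamma\<close> demands.
\<close>

lemma is_partial_gamma_canonical_count:
  assumes "n \<ge> 1"
  shows "is_partial_gamma n (\<lambda>i j. int (card
    {t \<in> ternary_increasing_trees n. canonical t \<and> y_leaves t = i \<and> z_leaves t = j}))"
    (is "is_partial_gamma n ?g")
proof -
  let ?K = "{t \<in> ternary_increasing_trees n. canonical t}"
  let ?P = "Sigma {1..n} (\<lambda>i. {0..(2 * n + 1 - i) div 2})"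
  let ?m = "\<lambda>i j. Z ^ i * ((X * Y) ^ j * (X + Y) ^ (2 * n + 1 - i - 2 * j))"
  note bounds = canonical_leaf_counts[OF _ _ assms]
  have "second_order_eulerian n =
     (\<Sum>t \<in> ?K. Z ^ y_leaves t * (X * Y) ^ z_leaves t * (X + Y) ^ lone_x_leaves t)"
    by (simp only: second_order_eulerian_eq_sum_trees[OF assms] sum_trees_eq_sum_canonical)
  also have "\<dots> = (\<Sum>t \<in> ?K. ?m (y_leaves t) (z_leaves t))"
    by (intro sum.cong) (simp_all add: bounds mult.assoc)
  also have "\<dots> = (\<Sum>p \<in> ?P. \<Sum>t \<in> {t \<in> ?K. (y_leaves t, z_leaves t) = p}.
      ?m (y_leaves t) (z_leaves t))"
    using bounds by (intro sum.group[symmetric]) (auto simp: finite_ternary_increasing_trees)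
  also have "\<dots> = (\<Sum>(i, j) \<in> ?P. of_int (?g i j) * ?m i j)"
    by (intro sum.cong) (auto simp: conj_assoc)
  also have "\<dots> = (\<Sum>i = 1..n. Z ^ i *
          (\<Sum>j = 0..(2 * n + 1 - i) div 2.
             of_int (?g i j) * (X * Y) ^ j * (X + Y) ^ (2 * n + 1 - i - 2 * j)))"
    by (subst sum.Sigma[symmetric]) (auto simp: sum_distrib_left mult_ac)
  finally have "second_order_eulerian n = \<dots>" .
  moreover have "?g i j = 0" if "\<not> (1 \<le> i \<and> i \<le> n \<and> j \<le> (2 * n + 1 - i) div 2)" for i j
  proof -
    have "{t \<in> ternary_increasing_trees n. canonical t \<and> y_leaves t = i \<and> z_leaves t = j} = {}"
      using that bounds by blast
    then show ?thesis by (simp only: card.empty of_nat_0)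
  qed
  ultimately show ?thesis unfolding is_partial_gamma_def by blast
qed

section \<open>Uniqueness of the expansion\<close>

text \<open>
  At \<open>y = 0\<close> only the term \<open>j = 0\<close> survives, so \<open>h 0 = 0\<close>. The remaining sum is divisible by
  \<open>x y\<close>, and the quotient has the same form with \<open>d - 2\<close> in place of \<open>d\<close>.
\<close>

lemma gamma_basis_independent:
  fixes h :: "nat \<Rightarrow> int"
  defines "x \<equiv> [:[:0, 1:]:] :: int poly poly" and "y \<equiv> [:0, 1:] :: int poly poly"
  assumes "2 * N \<le> d"
    and "(\<Sum>j = 0..N. of_int (h j) * (x * y) ^ j * (x + y) ^ (d - 2 * j)) = 0"
    and "j \<le> N"
  shows "h j = 0"
  using assms(3-)
proof (induction N arbitrary: d h j)
  case 0
  then have "of_int (h 0) * (x + y) ^ d = 0" by simp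
  moreover have "x + y \<noteq> 0" by (simp add: x_def y_def)
  ultimately show ?case using 0 by simp
next
  case (Suc N)
  obtain e where d: "d = Suc (Suc e)" "2 * N \<le> e"
    using Suc.prems(1) by (intro that[of "d - 2"]) auto
  have "(\<Sum>j = 0..Suc N. of_int (h j) * (x * y) ^ j * (x + y) ^ (d - 2 * j)) =
      of_int (h 0) * (x + y) ^ d +
      (\<Sum>j = 0..N. of_int (h (Suc j)) * (x * y) ^ Suc j * (x + y) ^ (d - 2 * Suc j))"
    by (simp only: sum.atLeast0_atMost_Suc_shift) simp
  also have "(\<Sum>j = 0..N. of_int (h (Suc j)) * (x * y) ^ Suc j * (x + y) ^ (d - 2 * Suc j)) =
      x * y * (\<Sum>j = 0..N. of_int (h (Suc j)) * (x * y) ^ j * (x + y) ^ (e - 2 * j))"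
    by (simp add: sum_distrib_left d mult_ac)
  finally have eq: "of_int (h 0) * (x + y) ^ d +
      x * y * (\<Sum>j = 0..N. of_int (h (Suc j)) * (x * y) ^ j * (x + y) ^ (e - 2 * j)) = 0"
    (is "_ + x * y * ?S = 0")
    using Suc.prems(2) by simp
  have "poly (of_int (h 0) * (x + y) ^ d + x * y * ?S) 0 = of_int (h 0) * [:0, 1:] ^ d"
    by (simp add: x_def y_def of_int_poly)
  then have "of_int (h 0) * [:0, 1:] ^ d = (0 :: int poly)"
    using eq by simp
  then have h0: "h 0 = 0" by simp
  then have "x * y * ?S = 0" using eq by simp
  moreover have "x * y \<noteq> 0" by (simp add: x_def y_def)
  ultimately have "?S = 0" by simp
  then have "h (Suc k) = 0" if "k \<le> N" for k
    using Suc.IH[OF d(2), of "\<lambda>j. h (Suc j)"] that by blast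
  then show ?case using h0 Suc.prems(3) by (cases j) auto
qed

text \<open>
  The inner sums do not involve \<open>Z\<close>, so each is the coefficient of the power \<open>Z\<^sup>i\<close> in front of
  it, and the preceding independence applies to each of them.
\<close>

lemma is_partial_gamma_unique:
  assumes f: "is_partial_gamma n f" and g: "is_partial_gamma n g"
  shows "f = g"
proof (intro ext)
  fix i j
  define x y :: "int poly poly" where "x = [:[:0, 1:]:]" and "y = [:0, 1:]"
  define q where "q = (\<lambda>h i. \<Sum>j = 0..(2 * n + 1 - i) div 2.
      of_int (h i j) * (x * y) ^ j * (x + y) ^ (2 * n + 1 - i - 2 * j))"
  have XY: "X = [:x:]" "Y = [:y:]" by (simp_all add: X_def Y_def x_def y_def)
  have const: "[:p:] ^ k = [:p ^ k:]" for p :: "int poly poly" and k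
    by (induction k) auto
  have sum_const: "(\<Sum>j\<in>A. [:p j:]) = [:\<Sum>j\<in>A. p j:]" for p :: "nat \<Rightarrow> int poly poly" and A
    by (induction A rule: infinite_finite_induct) auto
  have expansion: "second_order_eulerian n = (\<Sum>i = 1..n. monom (q h i) i)"
    if "is_partial_gamma n h" for h
  proof -
    have "second_order_eulerian n = (\<Sum>i = 1..n. Z ^ i *
          (\<Sum>j = 0..(2 * n + 1 - i) div 2.
             of_int (h i j) * (X * Y) ^ j * (X + Y) ^ (2 * n + 1 - i - 2 * j)))"
      using that by (simp add: is_partial_gamma_def)
    also have "\<dots> = (\<Sum>i = 1..n. Z ^ i * [:q h i:])"
      by (simp add: XY const of_int_poly sum_const q_def mult_ac)
    also have "\<dots> = (\<Sum>i = 1..n. monom (q h i) i)"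
      by (simp add: Z_def monom_altdef mult.commute)
    finally show ?thesis .
  qed
  show "f i j = g i j"
  proof (cases "1 \<le> i \<and> i \<le> n \<and> j \<le> (2 * n + 1 - i) div 2")
    case True
    have "coeff (\<Sum>i = 1..n. monom (q h i) i) i = q h i" for h
      using True by (simp add: coeff_sum)
    then have "q f i = q g i"
      using expansion[OF f] expansion[OF g] by metis
    then have "(\<Sum>j = 0..(2 * n + 1 - i) div 2.
        of_int (f i j - g i j) * (x * y) ^ j * (x + y) ^ (2 * n + 1 - i - 2 * j)) = 0"
      by (simp add: q_def left_diff_distrib sum_subtractf)
    then have "f i j - g i j = 0"
      unfolding x_def y_def using True
      by (intro gamma_basis_independent[where d = "2 * n + 1 - i" and h = "\<lambda>j. f i j - g i j"]) auto
    then show ?thesis by simp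
  next
    case False
    then show ?thesis using f g unfolding is_partial_gamma_def by metis
  qed
qed

theorem theorem6p2:
  fixes n i j :: nat
  assumes "n \<ge> 1" and "1 \<le> i" and "i \<le> n" and "j \<le> (2 * n + 1 - i) div 2"
  shows "partial_gamma n i j =
    int (card {t \<in> ternary_increasing_trees n. canonical t \<and> y_leaves t = i \<and> z_leaves t = j})"
proof -
  have "partial_gamma n = (\<lambda>i j. int (card
    {t \<in> ternary_increasing_trees n. canonical t \<and> y_leaves t = i \<and> z_leaves t = j}))"
    unfolding partial_gamma_def
    using is_partial_gamma_canonical_count[OF assms(1)] is_partial_gamma_unique
    by (intro the_equality) auto
  then show ?thesis by simp
qed

end
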